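(* Let $(X,C)$ and $(Y,K)$ be Archimedean partially ordered vector spaces such that $(X,C)$ is directed and $C$ equals the inf-sup hull (in $X$) of $[0,\infty)_{\mathcal{R}}$, the set of finite sums of extreme vectors of $C$. Then every positively homogeneous order-isomorphism $f\colon C\to K$ is linear, i.e. is the restriction to $C$ of a linear map $X\to Y$.
   Context: A partially ordered vector space $(X,C)$ is a real vector space $X$ with a cone $C$ ($C$ convex, $\lambda C\subseteq C$ for $\lambda\ge 0$, $C\cap(-C)=\{0\}$), ordered by $x\le y$ iff $y-x\in C$. It is Archimedean if, whenever $x\in X$, $y\in C$ and $nx\le y$ for all integers $n\ge1$, then $x\le 0$. It is directed if any two elements of $X$ have a common upper bound in $X$ (equivalently $X=C-C$). An order-isomorphism is an order preserving bijection whose inverse is also order preserving. A map $f\colon C\to K$ is positively homogeneous if $f(\lambda u)=\lambda f(u)$ for all $u\in C$ and $\lambda>0$. A vector $e\in C\setminus\{0\}$ is an extreme vector of $C$ if $0\le x\le e$ implies $x=\lambda e$ for some $\lambda\ge 0$. Put $[0,\infty)_{\mathcal{R}}=\{r_1+\cdots+r_n\colon r_i\in C\text{ an extreme vector for } i=1,\dots,n\}$. The inf-sup hull of $V\subseteq X$ is the set of all $x\in X$ for which there are index sets $A,B$ and elements $v_{\alpha,\beta}\in V$ ($\alpha\in A,\beta\in B$) with $x=\inf_{\alpha\in A}(\sup_{\beta\in B}v_{\alpha,\beta})$ (all these suprema and the infimum existing in $X$). *)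

theory Defs
  imports "HOL-Analysis.Analysis"
begin

definition cone_le :: "'a::real_vector set \<Rightarrow> 'a \<Rightarrow> 'a \<Rightarrow> bool" where
  "cone_le C x y \<longleftrightarrow> y - x \<in> C"

text \<open>A partially ordered vector space is a pair of a real vector space, here the whole type,
  and a pointed convex cone in it.\<close>

definition partially_ordered_vs :: "'a::real_vector set \<Rightarrow> bool" where
  "partially_ordered_vs C \<longleftrightarrow> convex C \<and> cone C \<and> C \<inter> uminus ` C = {0}"

definition archimedean_cone :: "'a::real_vector set \<Rightarrow> bool" where
  "archimedean_cone C \<longleftrightarrow>
     (\<forall>x. \<forall>y\<in>C. (\<forall>n\<ge>1. cone_le C (real n *\<^sub>R x) y) \<longrightarrow> cone_le C x 0)"

definition directed_cone :: "'a::real_vector set \<Rightarrow> bool" where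
  "directed_cone C \<longleftrightarrow> (\<forall>x y. \<exists>z. cone_le C x z \<and> cone_le C y z)"

definition is_sup :: "'a::real_vector set \<Rightarrow> 'a set \<Rightarrow> 'a \<Rightarrow> bool" where
  "is_sup C S s \<longleftrightarrow>
     (\<forall>x\<in>S. cone_le C x s) \<and> (\<forall>u. (\<forall>x\<in>S. cone_le C x u) \<longrightarrow> cone_le C s u)"

definition is_inf :: "'a::real_vector set \<Rightarrow> 'a set \<Rightarrow> 'a \<Rightarrow> bool" where
  "is_inf C S s \<longleftrightarrow>
     (\<forall>x\<in>S. cone_le C s x) \<and> (\<forall>l. (\<forall>x\<in>S. cone_le C l x) \<longrightarrow> cone_le C l s)"

definition extreme_vector :: "'a::real_vector set \<Rightarrow> 'a \<Rightarrow> bool" where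
  "extreme_vector C e \<longleftrightarrow> e \<in> C \<and> e \<noteq> 0 \<and>
     (\<forall>x. cone_le C 0 x \<and> cone_le C x e \<longrightarrow> (\<exists>c\<ge>0. x = c *\<^sub>R e))"

text \<open>The finite sums of extreme vectors; the empty sum \<open>0\<close> is included.\<close>

definition extreme_sums :: "'a::real_vector set \<Rightarrow> 'a set" where
  "extreme_sums C = {sum_list rs | rs. \<forall>r\<in>set rs. extreme_vector C r}"

text \<open>A definition cannot quantify over the types of the index sets, so they are taken to be sets
  of vectors. This loses nothing: the rows may be indexed by their suprema and their members by
  themselves, which is what \<open>inf_sup_hullI\<close> below expresses.\<close>

definition inf_sup_hull :: "'a::real_vector set \<Rightarrow> 'a set \<Rightarrow> 'a set" where
  "inf_sup_hull C V = {x. \<exists>(A::'a set) (B::'a set) v s.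
     (\<forall>a\<in>A. \<forall>b\<in>B. v a b \<in> V) \<and>
     (\<forall>a\<in>A. is_sup C (v a ` B) (s a)) \<and> is_inf C (s ` A) x}"

lemma inf_sup_hullI:
  fixes C V :: "'a::real_vector set" and A :: "'i set" and B :: "'j set"
  assumes v: "\<And>a b. a \<in> A \<Longrightarrow> b \<in> B \<Longrightarrow> v a b \<in> V"
    and s: "\<And>a. a \<in> A \<Longrightarrow> is_sup C (v a ` B) (s a)"
    and x: "is_inf C (s ` A) x"
  shows "x \<in> inf_sup_hull C V"
proof -
  define r where "r t = inv_into A s t" for t
  have r: "r t \<in> A" "s (r t) = t" if "t \<in> s ` A" for t
    using that by (auto simp: r_def inv_into_into f_inv_into_f)
  define B' where "B' = (if B = {} then {} else V)"
  define w where "w t u = (if u \<in> v (r t) ` B then u else v (r t) (SOME b. b \<in> B))" for t u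
  have row: "w t ` B' = v (r t) ` B" if "t \<in> s ` A" for t
  proof (cases "B = {}")
    case False
    then have "(SOME b. b \<in> B) \<in> B" by (simp add: some_in_eq)
    moreover have "v (r t) ` B \<subseteq> V" using v r(1)[OF that] by blast
    ultimately show ?thesis using False by (auto simp: w_def B'_def image_iff)
  qed (simp add: B'_def)
  have "\<forall>t\<in>s ` A. \<forall>u\<in>B'. w t u \<in> V"
    using row v r(1) by (smt (verit) image_iff)
  moreover have "\<forall>t\<in>s ` A. is_sup C (w t ` B') (id t)"
    using row s r by (metis id_apply)
  moreover have "is_inf C (id ` s ` A) x" using x by simp
  ultimately show ?thesis unfolding inf_sup_hull_def by blast
qed

definition order_isomorphism_on ::
  "'a::real_vector set \<Rightarrow> 'b::real_vector set \<Rightarrow> ('a \<Rightarrow> 'b) \<Rightarrow> bool" where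
  "order_isomorphism_on C K f \<longleftrightarrow> bij_betw f C K \<and>
     monotone_on C (cone_le C) (cone_le K) f \<and>
     monotone_on K (cone_le K) (cone_le C) (inv_into C f)"

definition positively_homogeneous_on ::
  "'a::real_vector set \<Rightarrow> ('a \<Rightarrow> 'b::real_vector) \<Rightarrow> bool" where
  "positively_homogeneous_on C f \<longleftrightarrow> (\<forall>u\<in>C. \<forall>c>0. f (c *\<^sub>R u) = c *\<^sub>R f u)"

end

theory Submission
  imports Defs
begin

text \<open>
  If \<open>e\<close> is extreme, the order interval from \<open>x\<close> to \<open>x + e\<close> is a chain, hence so is its image, and
  in an Archimedean space this makes \<open>f (x + e) - f x\<close> extreme. Comparing the growth of
  \<open>f (x + n *\<^sub>R e)\<close> with that of \<open>n *\<^sub>R f e\<close> shows that it is a multiple of \<open>f e\<close>. For non-parallel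
  extreme vectors \<open>r\<close> and \<open>e\<close>, computing \<open>f (y + r + e)\<close> in both orders and comparing the
  coefficients of \<open>f r\<close> and \<open>f e\<close> shows that \<open>f\<close> is additive on sums of extreme vectors.
  Suprema and infima then carry additivity to the inf-sup hull, first in one argument and then in
  the other.
\<close>

section \<open>Order and extreme vectors in an Archimedean space\<close>

locale archimedean_ordered_vs =
  fixes C :: "'a::real_vector set"
  assumes partially_ordered: "partially_ordered_vs C"
    and archimedean: "archimedean_cone C"
begin

abbreviation le :: "'a \<Rightarrow> 'a \<Rightarrow> bool" (infix "\<preceq>" 50) where
  "x \<preceq> y \<equiv> cone_le C x y"

lemma scale_mem: "x \<in> C \<Longrightarrow> c \<ge> 0 \<Longrightarrow> c *\<^sub>R x \<in> C"
  using partially_ordered by (auto simp: partially_ordered_vs_def cone_def)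

lemma add_mem:
  assumes "x \<in> C" and "y \<in> C"
  shows "x + y \<in> C"
proof -
  have "convex C \<and> cone C" using partially_ordered by (simp add: partially_ordered_vs_def)
  then show ?thesis using assms unfolding convex_cone by blast
qed

lemma zero_mem: "0 \<in> C"
  using partially_ordered by (auto simp: partially_ordered_vs_def)

lemma pointed: "x \<in> C \<Longrightarrow> - x \<in> C \<Longrightarrow> x = 0"
proof -
  assume "x \<in> C" "- x \<in> C"
  then have "x \<in> C \<inter> uminus ` C" by (metis IntI add.inverse_inverse imageI)
  then show "x = 0" using partially_ordered by (auto simp: partially_ordered_vs_def)
qed

lemma le_trans: "x \<preceq> y \<Longrightarrow> y \<preceq> z \<Longrightarrow> x \<preceq> z"
  unfolding cone_le_def using add_mem[of "y - x" "z - y"] by (simp add: algebra_simps)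

lemma le_antisym: "x \<preceq> y \<Longrightarrow> y \<preceq> x \<Longrightarrow> x = y"
  unfolding cone_le_def using pointed[of "y - x"] by simp

lemma zero_le_iff: "0 \<preceq> x \<longleftrightarrow> x \<in> C"
  by (simp add: cone_le_def)

lemma mem_upward: "x \<in> C \<Longrightarrow> x \<preceq> y \<Longrightarrow> y \<in> C"
  using le_trans zero_le_iff by blast

lemma le_scale: "x \<preceq> y \<Longrightarrow> c \<ge> 0 \<Longrightarrow> c *\<^sub>R x \<preceq> c *\<^sub>R y"
  unfolding cone_le_def using scale_mem[of "y - x" c] by (simp add: scaleR_diff_right)

lemma scale_mono: "x \<in> C \<Longrightarrow> a \<le> b \<Longrightarrow> a *\<^sub>R x \<preceq> b *\<^sub>R x"
  unfolding cone_le_def using scale_mem[of x "b - a"] by (simp add: scaleR_diff_left)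

lemma le_add_left: "x \<in> C \<Longrightarrow> y \<preceq> x + y"
  by (simp add: cone_le_def)

lemma le_add_right: "x \<in> C \<Longrightarrow> y \<preceq> y + x"
  by (simp add: cone_le_def)

lemma archimedeanD: "y \<in> C \<Longrightarrow> (\<And>n. n \<ge> 1 \<Longrightarrow> real n *\<^sub>R x \<preceq> y) \<Longrightarrow> x \<preceq> 0"
  using archimedean unfolding archimedean_cone_def by blast

lemma archimedean_eq:
  assumes "x \<in> C" and "y \<in> C" and "\<And>n. n \<ge> 1 \<Longrightarrow> real n *\<^sub>R x \<preceq> y"
  shows "x = 0"
  using archimedeanD[OF assms(2,3)] assms(1) le_antisym zero_le_iff by blast

lemma extreme_mem: "extreme_vector C e \<Longrightarrow> e \<in> C"
  and extreme_nonzero: "extreme_vector C e \<Longrightarrow> e \<noteq> 0"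
  by (auto simp: extreme_vector_def)

lemma extremeD:
  assumes "extreme_vector C e" and "x \<in> C" and "x \<preceq> e"
  obtains c where "c \<ge> 0" and "x = c *\<^sub>R e"
  using assms zero_le_iff unfolding extreme_vector_def by blast

lemma extreme_scale:
  assumes e: "extreme_vector C e" and c: "c > 0"
  shows "extreme_vector C (c *\<^sub>R e)"
  unfolding extreme_vector_def
proof (intro conjI allI impI)
  show "c *\<^sub>R e \<in> C" using e c by (simp add: extreme_mem scale_mem)
  show "c *\<^sub>R e \<noteq> 0" using e c by (simp add: extreme_nonzero)
  fix x assume x: "0 \<preceq> x \<and> x \<preceq> c *\<^sub>R e"
  have "(1 / c) *\<^sub>R x \<in> C" using x c by (simp add: zero_le_iff scale_mem)
  moreover have "(1 / c) *\<^sub>R x \<preceq> e" using le_scale[of x "c *\<^sub>R e" "1 / c"] x c by simp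
  ultimately obtain d where d: "d \<ge> 0" "(1 / c) *\<^sub>R x = d *\<^sub>R e" using e extremeD by blast
  have "x = c *\<^sub>R (1 / c) *\<^sub>R x" using c by simp
  also have "\<dots> = c *\<^sub>R d *\<^sub>R e" using d(2) by (simp only:)
  also have "\<dots> = d *\<^sub>R c *\<^sub>R e" by (simp only: scaleR_scaleR mult.commute)
  finally show "\<exists>d\<ge>0. x = d *\<^sub>R c *\<^sub>R e" using d(1) by blast
qed

text \<open>For \<open>y\<close> below \<open>z\<close>, let \<open>t\<close> be the supremum of the
  scalars \<open>s\<close> in [0,1] with \<open>s z\<close> below \<open>y\<close>. The chain
  condition puts \<open>y\<close> below every larger multiple of \<open>z\<close>, and the
  Archimedean property squeezes \<open>y\<close> onto \<open>t z\<close>.\<close>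

lemma extreme_if_chain:
  assumes z: "z \<in> C" "z \<noteq> 0"
    and chain: "\<And>x y. x \<in> C \<Longrightarrow> y \<in> C \<Longrightarrow> x \<preceq> z \<Longrightarrow> y \<preceq> z \<Longrightarrow> x \<preceq> y \<or> y \<preceq> x"
  shows "extreme_vector C z"
  unfolding extreme_vector_def
proof (intro conjI allI impI)
  fix y assume "0 \<preceq> y \<and> y \<preceq> z"
  then have y: "y \<in> C" "y \<preceq> z" by (auto simp: zero_le_iff)
  define S where "S = {s. 0 \<le> s \<and> s \<le> 1 \<and> s *\<^sub>R z \<preceq> y}"
  define t where "t = Sup S"
  have S0: "0 \<in> S" using y(1) by (simp add: S_def zero_le_iff)
  have bdd: "bdd_above S" by (auto simp: S_def bdd_above_def)
  have t0: "0 \<le> t" unfolding t_def using S0 bdd by (rule cSup_upper)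
  have t1: "t \<le> 1" unfolding t_def by (rule cSup_least) (use S0 in blast, simp add: S_def)
  \<comment> \<open>A supremum need not be attained a priori. Some element of \<open>S\<close>
    exceeds \<open>t - 1/n\<close>, so \<open>n (t z - y)\<close> stays below \<open>z\<close> for
    every \<open>n\<close>.\<close>
  have "t *\<^sub>R z - y \<preceq> 0"
  proof (rule archimedeanD[OF z(1)])
    fix n :: nat assume n: "n \<ge> 1"
    have "t - 1 / n < Sup S" using n by (simp add: t_def)
    then obtain s where s: "s \<in> S" "t - 1 / n < s" using less_cSupD S0 by (metis empty_iff)
    have "(t - 1 / n) *\<^sub>R z \<preceq> y"
      using scale_mono[OF z(1), of "t - 1 / n" s] s le_trans by (auto simp: S_def)
    from le_scale[OF this, of "real n"] show "real n *\<^sub>R (t *\<^sub>R z - y) \<preceq> z"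
      using n by (simp add: cone_le_def algebra_simps)
  qed
  then have ge: "t *\<^sub>R z \<preceq> y" by (simp add: cone_le_def)
  have "y - t *\<^sub>R z = 0"
  proof (rule archimedean_eq[OF _ z(1)])
    show "y - t *\<^sub>R z \<in> C" using ge by (simp add: cone_le_def)
    fix n :: nat assume n: "n \<ge> 1"
    \<comment> \<open>The chain condition only compares vectors below \<open>z\<close>, hence the
      case split. If \<open>t + 1/n\<close> exceeds 1, the bound follows from \<open>y\<close> being
      below \<open>z\<close>.\<close>
    have "y \<preceq> (t + 1 / n) *\<^sub>R z"
    proof (cases "t + 1 / n \<le> 1")
      case True
      have "t + 1 / n \<notin> S" using cSup_upper[OF _ bdd, of "t + 1 / n"] n by (auto simp: t_def)
      then have "\<not> (t + 1 / n) *\<^sub>R z \<preceq> y" using True t0 by (auto simp: S_def)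
      moreover have "(t + 1 / n) *\<^sub>R z \<preceq> z" using scale_mono[OF z(1) True] by simp
      moreover have "(t + 1 / n) *\<^sub>R z \<in> C" using z(1) t0 by (intro scale_mem) auto
      ultimately show ?thesis using chain y by blast
    next
      case False
      then show ?thesis using scale_mono[OF z(1), of 1 "t + 1 / n"] y(2) le_trans by auto
    qed
    from le_scale[OF this, of "real n"] show "real n *\<^sub>R (y - t *\<^sub>R z) \<preceq> z"
      using n by (simp add: cone_le_def algebra_simps)
  qed
  then show "\<exists>c\<ge>0. y = c *\<^sub>R z" using t0 by auto
qed (use z in auto)

lemma extreme_sums_mem: "v \<in> extreme_sums C \<Longrightarrow> v \<in> C"
proof -
  have "\<forall>r\<in>set rs. extreme_vector C r \<Longrightarrow> sum_list rs \<in> C" for rs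
    by (induction rs) (auto simp: zero_mem add_mem extreme_mem)
  then show "v \<in> extreme_sums C \<Longrightarrow> v \<in> C" by (auto simp: extreme_sums_def)
qed

end

section \<open>Translation of suprema and infima\<close>

lemma is_sup_translate:
  assumes "is_sup C S s"
  shows "is_sup C ((\<lambda>x. x + z) ` S) (s + z)"
proof -
  have "cone_le C (s + z) u" if "\<forall>x\<in>S. cone_le C (x + z) u" for u
  proof -
    have "\<forall>x\<in>S. cone_le C x (u - z)" using that by (simp add: cone_le_def diff_diff_eq add.commute)
    then have "cone_le C s (u - z)" using assms by (simp add: is_sup_def)
    then show ?thesis by (simp add: cone_le_def diff_diff_eq add.commute)
  qed
  then show ?thesis using assms by (simp add: is_sup_def cone_le_def)
qed

lemma is_inf_translate:
  assumes "is_inf C S s"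
  shows "is_inf C ((\<lambda>x. x + z) ` S) (s + z)"
proof -
  have "cone_le C l (s + z)" if "\<forall>x\<in>S. cone_le C l (x + z)" for l
  proof -
    have "\<forall>x\<in>S. cone_le C (l - z) x" using that by (simp add: cone_le_def diff_diff_eq2)
    then have "cone_le C (l - z) s" using assms by (simp add: is_inf_def)
    then show ?thesis by (simp add: cone_le_def diff_diff_eq2)
  qed
  then show ?thesis using assms by (simp add: is_inf_def cone_le_def)
qed

section \<open>Basic properties of homogeneous order-isomorphisms of cones\<close>

locale homogeneous_order_isomorphism =
  dom: archimedean_ordered_vs C + cod: archimedean_ordered_vs K
  for C :: "'a::real_vector set" and K :: "'b::real_vector set" +
  fixes f :: "'a \<Rightarrow> 'b"
  assumes order_iso: "order_isomorphism_on C K f"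
    and homogeneous: "positively_homogeneous_on C f"
begin

lemma bij: "bij_betw f C K"
  using order_iso by (simp add: order_isomorphism_on_def)

lemma image_mem: "x \<in> C \<Longrightarrow> f x \<in> K"
  using bij bij_betwE by blast

lemma injD: "x \<in> C \<Longrightarrow> y \<in> C \<Longrightarrow> f x = f y \<Longrightarrow> x = y"
  using bij by (auto simp: bij_betw_def inj_on_def)

lemma preimage:
  assumes "y \<in> K"
  obtains x where "x \<in> C" and "f x = y"
  using assms bij by (auto simp: bij_betw_def)

lemma le_iff:
  assumes "x \<in> C" and "y \<in> C"
  shows "cone_le K (f x) (f y) \<longleftrightarrow> cone_le C x y"
proof
  assume "cone_le K (f x) (f y)"
  then have "cone_le C (inv_into C f (f x)) (inv_into C f (f y))"
    using order_iso assms image_mem by (auto simp: order_isomorphism_on_def monotone_on_def)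
  then show "cone_le C x y" using assms bij by (simp add: bij_betw_def)
qed (use order_iso assms in \<open>auto simp: order_isomorphism_on_def monotone_on_def\<close>)

lemma image_scale_pos: "x \<in> C \<Longrightarrow> c > 0 \<Longrightarrow> f (c *\<^sub>R x) = c *\<^sub>R f x"
  using homogeneous by (simp add: positively_homogeneous_on_def)

lemma image_zero: "f 0 = 0"
proof -
  have "f 0 = 2 *\<^sub>R f 0" using image_scale_pos[of 0 2] dom.zero_mem by simp
  then show ?thesis by (simp add: scaleR_2)
qed

lemma image_scale: "x \<in> C \<Longrightarrow> c \<ge> 0 \<Longrightarrow> f (c *\<^sub>R x) = c *\<^sub>R f x"
  using image_scale_pos image_zero by (cases "c = 0") auto

lemma image_nonzero: "x \<in> C \<Longrightarrow> x \<noteq> 0 \<Longrightarrow> f x \<noteq> 0"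
  using injD[of x 0] image_zero dom.zero_mem by auto

section \<open>Increments of \<open>f\<close> along extreme vectors\<close>

lemma extreme_increment:
  assumes x: "x \<in> C" and e: "extreme_vector C e"
  shows "extreme_vector K (f (x + e) - f x)"
proof (rule cod.extreme_if_chain)
  have eC: "e \<in> C" and xe: "x + e \<in> C" using e x by (auto simp: dom.extreme_mem dom.add_mem)
  show "f (x + e) - f x \<in> K"
    using le_iff[OF x xe] dom.le_add_right[OF eC] by (simp add: cone_le_def)
  show "f (x + e) - f x \<noteq> 0" using injD[OF xe x] dom.extreme_nonzero[OF e] by auto
  \<comment> \<open>The vector \<open>w + f x\<close> is the image of some \<open>u\<close> between
    \<open>x\<close> and \<open>x + e\<close>, and extremality of \<open>e\<close> puts
    \<open>u\<close> on the ray from \<open>x\<close> along \<open>e\<close>. Vectors below the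
    increment are thus indexed by a real parameter, monotonically by \<open>mono\<close>, so they
    form a chain.\<close>
  have on_segment: "\<exists>c. w = f (x + c *\<^sub>R e) - f x \<and> c \<ge> 0"
    if w: "w \<in> K" "cone_le K w (f (x + e) - f x)" for w
  proof -
    have "w + f x \<in> K" using w(1) x by (simp add: cod.add_mem image_mem)
    then obtain u where u: "u \<in> C" "f u = w + f x" by (rule preimage)
    have "cone_le K (f x) (f u)" "cone_le K (f u) (f (x + e))"
      using w u by (auto simp: cone_le_def algebra_simps)
    then have "cone_le C x u" "cone_le C u (x + e)" using le_iff x xe u(1) by auto
    then have "u - x \<in> C" "cone_le C (u - x) e" by (auto simp: cone_le_def algebra_simps)
    then obtain c where "c \<ge> 0" "u - x = c *\<^sub>R e" using dom.extremeD[OF e] by blast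
    moreover from this have "u = x + c *\<^sub>R e" by (simp add: algebra_simps)
    ultimately show ?thesis using u(2) by (intro exI[of _ c]) (simp add: algebra_simps)
  qed
  have mono: "cone_le K (f (x + a *\<^sub>R e) - f x) (f (x + b *\<^sub>R e) - f x)"
    if "0 \<le> a" "a \<le> b" for a b
  proof -
    have "cone_le C (x + a *\<^sub>R e) (x + b *\<^sub>R e)"
      using dom.scale_mono[OF eC that(2)] by (simp add: cone_le_def)
    moreover have "x + a *\<^sub>R e \<in> C" "x + b *\<^sub>R e \<in> C"
      using that x eC by (auto simp: dom.add_mem dom.scale_mem)
    ultimately have "cone_le K (f (x + a *\<^sub>R e)) (f (x + b *\<^sub>R e))" using le_iff by simp
    then show ?thesis by (simp add: cone_le_def)
  qed
  fix v w
  assume "v \<in> K" "w \<in> K" "cone_le K v (f (x + e) - f x)" "cone_le K w (f (x + e) - f x)"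
  then obtain a b where "v = f (x + a *\<^sub>R e) - f x" "a \<ge> 0" "w = f (x + b *\<^sub>R e) - f x" "b \<ge> 0"
    using on_segment by blast
  then show "cone_le K v w \<or> cone_le K w v" using mono[of a b] mono[of b a] by fastforce
qed

text \<open>All increments from \<open>x\<close> along multiples of \<open>e\<close> lie on the ray
  of \<open>r\<close>, say with coefficients \<open>c n\<close>. Homogeneity bounds
  \<open>c n / n\<close> from above, and the same growth rate must dominate \<open>f e\<close>. So
  \<open>f e\<close> lies below a multiple of the extreme vector \<open>r\<close> and is itself a
  multiple of it.\<close>

lemma increment_parallel:
  assumes x: "x \<in> C" and e: "extreme_vector C e"
  obtains d where "f (x + e) = f x + d *\<^sub>R f e"
proof -
  define r where "r = f (x + e) - f x"
  have eC: "e \<in> C" and xe: "x + e \<in> C" using e x by (auto simp: dom.extreme_mem dom.add_mem)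
  have r: "extreme_vector K r" unfolding r_def using extreme_increment x e .
  have rK: "r \<in> K" and r0: "r \<noteq> 0" using r by (auto simp: cod.extreme_mem cod.extreme_nonzero)
  have "\<exists>c. f (x + real n *\<^sub>R e) = f x + c *\<^sub>R r" if n: "n \<ge> 1" for n :: nat
  proof -
    have ne: "extreme_vector C (real n *\<^sub>R e)" using dom.extreme_scale[OF e] n by simp
    have xne: "x + real n *\<^sub>R e \<in> C" using x ne by (simp add: dom.add_mem dom.extreme_mem)
    have "cone_le C (x + e) (x + real n *\<^sub>R e)"
      using dom.scale_mono[OF eC, of 1 "real n"] n by (simp add: cone_le_def)
    then have "cone_le K (f (x + e)) (f (x + real n *\<^sub>R e))" using le_iff xe xne by simp
    then have "cone_le K r (f (x + real n *\<^sub>R e) - f x)" by (simp add: cone_le_def r_def)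
    \<comment> \<open>Extremality applies to the larger increment, so \<open>r\<close> is first
      expressed through it and the relation is then inverted.\<close>
    then obtain c where c: "r = c *\<^sub>R (f (x + real n *\<^sub>R e) - f x)"
      using cod.extremeD[OF extreme_increment[OF x ne] rK] by blast
    then have "c \<noteq> 0" using r0 by auto
    then have "f (x + real n *\<^sub>R e) = f x + (1 / c) *\<^sub>R r" by (simp add: c)
    then show ?thesis by blast
  qed
  then obtain c where c: "\<And>n::nat. n \<ge> 1 \<Longrightarrow> f (x + real n *\<^sub>R e) = f x + c n *\<^sub>R r" by metis
  have upper: "cone_le K ((c n / n) *\<^sub>R r) (f (x + e))" if n: "n \<ge> 1" for n :: nat
  proof -
    have "cone_le C (x + real n *\<^sub>R e) (real n *\<^sub>R (x + e))"
      using dom.scale_mono[OF x, of 1 "real n"] n by (simp add: cone_le_def algebra_simps)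
    moreover have "x + real n *\<^sub>R e \<in> C" using x eC by (simp add: dom.add_mem dom.scale_mem)
    ultimately have "cone_le K (f (x + real n *\<^sub>R e)) (f (real n *\<^sub>R (x + e)))"
      using le_iff dom.scale_mem[OF xe] by simp
    then have "cone_le K (f x + c n *\<^sub>R r) (real n *\<^sub>R f (x + e))"
      using c[OF n] image_scale[OF xe] by simp
    moreover have "cone_le K (c n *\<^sub>R r) (f x + c n *\<^sub>R r)"
      using cod.le_add_left image_mem[OF x] by simp
    ultimately have "cone_le K (c n *\<^sub>R r) (real n *\<^sub>R f (x + e))" using cod.le_trans by blast
    from cod.le_scale[OF this, of "1 / n"] show ?thesis using n by simp
  qed
  \<comment> \<open>Otherwise, by \<open>upper\<close>, every multiple of \<open>r\<close> would lie
    below the fixed vector \<open>f (x + e)\<close>, forcing \<open>r = 0\<close>.\<close>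
  have "\<exists>M. \<forall>n\<ge>1. c n / real n \<le> M"
  proof (rule ccontr)
    assume unbounded: "\<not> ?thesis"
    have "r = 0"
    proof (rule cod.archimedean_eq[OF rK image_mem[OF xe]])
      fix m :: nat
      obtain n where "n \<ge> 1" "real m < c n / real n" using unbounded by (meson not_less)
      then show "cone_le K (real m *\<^sub>R r) (f (x + e))"
        using cod.scale_mono[OF rK, of "real m" "c n / n"] upper cod.le_trans by auto
    qed
    then show False using r0 by simp
  qed
  then obtain M where M: "\<And>n::nat. n \<ge> 1 \<Longrightarrow> c n / n \<le> M" by blast
  \<comment> \<open>From \<open>n f e = f (n e)\<close>, which is below \<open>f (x + n e)\<close>,
    the multiples of \<open>f e - M r\<close> are all bounded by \<open>f x\<close>.\<close>
  have "cone_le K (f e - M *\<^sub>R r) 0"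
  proof (rule cod.archimedeanD[OF image_mem[OF x]])
    fix n :: nat assume n: "n \<ge> 1"
    have "x + real n *\<^sub>R e \<in> C" "real n *\<^sub>R e \<in> C"
      using x eC by (auto simp: dom.add_mem dom.scale_mem)
    then have "cone_le K (f (real n *\<^sub>R e)) (f (x + real n *\<^sub>R e))"
      using le_iff dom.le_add_left[OF x] by simp
    then have "cone_le K (real n *\<^sub>R f e) (f x + c n *\<^sub>R r)"
      using c[OF n] image_scale[OF eC] by simp
    moreover have "cone_le K (f x + c n *\<^sub>R r) (f x + (real n * M) *\<^sub>R r)"
      using cod.scale_mono[OF rK, of "c n" "real n * M"] M[OF n] n
      by (simp add: cone_le_def field_simps)
    ultimately have "cone_le K (real n *\<^sub>R f e) (f x + (real n * M) *\<^sub>R r)"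
      using cod.le_trans by blast
    then show "cone_le K (real n *\<^sub>R (f e - M *\<^sub>R r)) (f x)"
      by (simp add: cone_le_def algebra_simps)
  qed
  then have "cone_le K (f e) (M *\<^sub>R r)" by (simp add: cone_le_def)
  \<comment> \<open>The maximum makes the factor positive, as \<open>extreme_scale\<close>
    requires.\<close>
  also have "cone_le K (M *\<^sub>R r) (max 1 M *\<^sub>R r)" using cod.scale_mono[OF rK] by simp
  finally (cod.le_trans) have "cone_le K (f e) (max 1 M *\<^sub>R r)" .
  then obtain a where a: "f e = a *\<^sub>R max 1 M *\<^sub>R r"
    using cod.extremeD[OF cod.extreme_scale[OF r] image_mem[OF eC], of "max 1 M"]
    by (metis less_max_iff_disj zero_less_one)
  define b where "b = a * max 1 M"
  have b: "f e = b *\<^sub>R r" using a by (simp add: b_def)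
  then have "b \<noteq> 0" using image_nonzero[OF eC] dom.extreme_nonzero[OF e] by auto
  then have "f (x + e) = f x + (1 / b) *\<^sub>R f e" using b by (simp add: r_def)
  then show thesis by (rule that)
qed

section \<open>Additivity on sums of extreme vectors\<close>

lemma image_parallel:
  assumes "x \<in> C" and "y \<in> C" and "x \<noteq> 0" and eq: "f x = c *\<^sub>R f y"
  shows "c > 0" and "x = c *\<^sub>R y"
proof -
  show c: "c > 0"
  proof (rule ccontr)
    assume "\<not> c > 0"
    \<comment> \<open>With \<open>c\<close> nonpositive, both \<open>f x\<close> and its negative
      lie in \<open>K\<close>, against pointedness.\<close>
    then have "- f x \<in> K" using cod.scale_mem[OF image_mem, of y "- c"] assms by simp
    then show False using cod.pointed image_mem image_nonzero assms by blast
  qed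
  have "f x = f (c *\<^sub>R y)" using eq image_scale_pos[OF _ c] assms by simp
  then show "x = c *\<^sub>R y" using injD dom.scale_mem c assms by simp
qed

lemma additive_extreme:
  assumes "\<forall>r\<in>set rs. extreme_vector C r" and "extreme_vector C e"
  shows "f (sum_list rs + e) = f (sum_list rs) + f e"
  using assms
\<comment> \<open>The vector \<open>e\<close> is generalised because the induction hypothesis is
  needed for \<open>r\<close>, for \<open>e\<close>, and for multiples of \<open>e\<close>.\<close>
proof (induction rs arbitrary: e)
  case Nil
  then show ?case by (simp add: image_zero)
next
  case (Cons r rs)
  define y where "y = sum_list rs"
  have y: "y \<in> C"
    unfolding y_def using Cons.prems by (intro dom.extreme_sums_mem) (auto simp: extreme_sums_def)
  have r: "extreme_vector C r" and e: "extreme_vector C e" using Cons.prems by auto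
  have IH: "f (y + e') = f y + f e'" if "extreme_vector C e'" for e'
    using Cons that by (simp add: y_def)
  have rC: "r \<in> C" and eC: "e \<in> C" using r e by (auto simp: dom.extreme_mem)
  have "f (y + r + e) = f y + f r + f e"
  proof (cases "\<exists>c>0. r = c *\<^sub>R e")
    case True
    then obtain c where c: "c > 0" "r = c *\<^sub>R e" by blast
    \<comment> \<open>Parallel vectors merge into the single extreme vector
      \<open>r + e = (1 + c) e\<close>.\<close>
    have "f (y + (1 + c) *\<^sub>R e) = f y + (1 + c) *\<^sub>R f e"
      using IH[OF dom.extreme_scale[OF e]] c(1) image_scale_pos[OF eC] by simp
    then show ?thesis using c image_scale_pos[OF eC] by (simp add: algebra_simps)
  next
    case False
    obtain d where d: "f (y + r + e) = f (y + r) + d *\<^sub>R f e"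
      using increment_parallel[OF _ e, of "y + r"] dom.add_mem y rC by blast
    obtain h where h: "f (y + e + r) = f (y + e) + h *\<^sub>R f r"
      using increment_parallel[OF _ r, of "y + e"] dom.add_mem y eC by blast
    have eq: "(1 - h) *\<^sub>R f r = (1 - d) *\<^sub>R f e"
      using d h IH[OF r] IH[OF e] by (simp add: algebra_simps)
    \<comment> \<open>Otherwise \<open>eq\<close> makes \<open>f r\<close> a multiple of
      \<open>f e\<close>, and \<open>image_parallel\<close> pulls this back to \<open>r\<close>
      being a positive multiple of \<open>e\<close>.\<close>
    have "h = 1"
    proof (rule ccontr)
      assume "h \<noteq> 1"
      then have "f r = (1 / (1 - h)) *\<^sub>R ((1 - h) *\<^sub>R f r)" by simp
      also have "\<dots> = ((1 - d) / (1 - h)) *\<^sub>R f e" by (simp add: eq)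
      finally show False
        using image_parallel[OF rC eC] dom.extreme_nonzero[OF r] False by blast
    qed
    then show ?thesis using h IH[OF e] by (simp add: algebra_simps)
  qed
  then show ?case using IH[OF r] by (simp add: y_def algebra_simps)
qed

lemma additive_extreme_sums:
  assumes v: "v \<in> extreme_sums C" and w: "w \<in> extreme_sums C"
  shows "f (v + w) = f v + f w"
proof -
  obtain rs where rs: "v = sum_list rs" "\<forall>r\<in>set rs. extreme_vector C r"
    using v by (auto simp: extreme_sums_def)
  obtain qs where qs: "w = sum_list qs" "\<forall>r\<in>set qs. extreme_vector C r"
    using w by (auto simp: extreme_sums_def)
  have "f (sum_list rs + sum_list qs) = f (sum_list rs) + f (sum_list qs)"
    using qs(2)
  proof (induction qs)
    case (Cons q qs)
    then have q: "extreme_vector C q" and ext: "\<forall>r\<in>set qs. extreme_vector C r" by auto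
    \<comment> \<open>The concatenated list again consists of extreme vectors, so \<open>q\<close>
      splits off the total sum just as it splits off the sum of \<open>qs\<close>.\<close>
    have "f (sum_list (rs @ qs) + q) = f (sum_list (rs @ qs)) + f q"
      using rs(2) ext by (intro additive_extreme[OF _ q]) auto
    then show ?case
      using Cons.IH[OF ext] additive_extreme[OF ext q] by (simp add: algebra_simps)
  qed (simp add: image_zero)
  then show ?thesis using rs qs by simp
qed

section \<open>Passage to the inf-sup hull\<close>

lemma image_sup:
  assumes S: "S \<subseteq> C" "S \<noteq> {}" and s: "is_sup C S s"
  shows "is_sup K (f ` S) (f s)"
proof -
  obtain x where x: "x \<in> S" using S by blast
  have "cone_le C x s" using s x by (simp add: is_sup_def)
  then have sC: "s \<in> C" using x S dom.mem_upward by blast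
  have least: "cone_le K (f s) u" if u: "\<forall>x\<in>S. cone_le K (f x) u" for u
  proof -
    \<comment> \<open>Nonemptiness of \<open>S\<close> matters here: an upper bound of the images
      lies above an element of \<open>K\<close>, hence in \<open>K\<close>, and so is itself an
      image.\<close>
    have "u \<in> K" using u x S cod.mem_upward image_mem by blast
    then obtain w where w: "w \<in> C" "f w = u" by (rule preimage)
    then have "\<forall>x\<in>S. cone_le C x w" using u S le_iff by blast
    then show ?thesis using s w sC le_iff by (auto simp: is_sup_def)
  qed
  have "\<forall>x\<in>S. cone_le K (f x) (f s)" using s S sC le_iff by (auto simp: is_sup_def)
  then show ?thesis using least by (auto simp: is_sup_def)
qed

lemma is_sup_unique: "is_sup K S s \<Longrightarrow> is_sup K S t \<Longrightarrow> s = t"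
  unfolding is_sup_def using cod.le_antisym by blast

text \<open>An infimum in \<open>C\<close> need only be mapped to a greatest lower bound among elements of \<open>K\<close>, since
  lower bounds in the ambient space are not images under \<open>f\<close>.\<close>

lemma image_inf_greatest:
  assumes S: "S \<subseteq> C" and s: "s \<in> C" "is_inf C S s"
    and l: "l \<in> K" "\<And>x. x \<in> S \<Longrightarrow> cone_le K l (f x)"
  shows "cone_le K l (f s)"
proof -
  obtain w where w: "w \<in> C" "f w = l" using l(1) by (rule preimage)
  then have "\<forall>x\<in>S. cone_le C w x" using l(2) S le_iff by blast
  then show ?thesis using s w le_iff by (auto simp: is_inf_def)
qed

text \<open>With \<open>z\<close> fixed, additivity passes from \<open>V\<close> to the row suprema
  by uniqueness of suprema. It passes to their infimum by two inequalities, each from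
  \<open>image_inf_greatest\<close> with a lower bound chosen inside \<open>K\<close>.\<close>

lemma additive_hull:
  assumes V: "V \<subseteq> C" and z: "z \<in> C" and add: "\<And>v. v \<in> V \<Longrightarrow> f (v + z) = f v + f z"
    and x: "x \<in> C" "x \<in> inf_sup_hull C V"
  shows "f (x + z) = f x + f z"
proof (cases "C = {0}")
  case True
  then show ?thesis using x z by (simp add: image_zero)
next
  case False
  \<comment> \<open>A nonzero \<open>p\<close> excludes empty rows: the supremum of the empty set
    would be a least element of the whole space, yet subtracting \<open>p\<close> goes strictly
    lower.\<close>
  then obtain p where p: "p \<in> C" "p \<noteq> 0" using dom.zero_mem by blast
  then have np: "- p \<notin> C" using dom.pointed by blast
  obtain A B :: "'a set" and v s where
    v: "\<And>a b. a \<in> A \<Longrightarrow> b \<in> B \<Longrightarrow> v a b \<in> V" and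
    s: "\<And>a. a \<in> A \<Longrightarrow> is_sup C (v a ` B) (s a)" and inf: "is_inf C (s ` A) x"
    using x(2) unfolding inf_sup_hull_def by blast
  have "B \<noteq> {}" if "a \<in> A" for a
  proof
    assume "B = {}"
    then have "cone_le C (s a) (s a - p)" using s[OF that] by (auto simp: is_sup_def)
    then show False using np by (simp add: cone_le_def)
  qed
  then have rows: "v a ` B \<subseteq> C" "v a ` B \<noteq> {}" if "a \<in> A" for a using v V that by blast+
  have sC: "s a \<in> C" if a: "a \<in> A" for a
  proof -
    obtain b where b: "b \<in> B" "v a b \<in> C" using rows[OF a] by blast
    then have "cone_le C (v a b) (s a)" using s[OF a] by (simp add: is_sup_def)
    then show ?thesis using b dom.mem_upward by blast
  qed
  have s_add: "f (s a + z) = f (s a) + f z" if a: "a \<in> A" for a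
  proof (rule is_sup_unique)
    have "is_sup C ((\<lambda>x. x + z) ` v a ` B) (s a + z)" using s[OF a] by (rule is_sup_translate)
    then have "is_sup K (f ` (\<lambda>x. x + z) ` v a ` B) (f (s a + z))"
      using rows[OF a] z dom.add_mem by (intro image_sup) auto
    also have "f ` (\<lambda>x. x + z) ` v a ` B = (\<lambda>x. x + f z) ` f ` v a ` B"
      using add v[OF a] by (auto simp: image_iff)
    finally show "is_sup K ((\<lambda>x. x + f z) ` f ` v a ` B) (f (s a + z))" .
    show "is_sup K ((\<lambda>x. x + f z) ` f ` v a ` B) (f (s a) + f z)"
      using image_sup[OF rows[OF a] s[OF a]] by (rule is_sup_translate)
  qed
  have lower: "cone_le C x (s a)" if "a \<in> A" for a using inf that by (auto simp: is_inf_def)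
  have xz: "x + z \<in> C" using x z by (simp add: dom.add_mem)
  show ?thesis
  proof (rule cod.le_antisym)
    \<comment> \<open>Subtracting \<open>f z\<close> gives a lower bound of the
      \<open>f (s a)\<close> that still lies in \<open>K\<close>, since \<open>z\<close> is below
      \<open>x + z\<close>.\<close>
    have "cone_le K (f (x + z) - f z) (f x)"
    proof (rule image_inf_greatest[OF _ x(1) inf])
      show "s ` A \<subseteq> C" using sC by blast
      show "f (x + z) - f z \<in> K"
        using le_iff[OF z xz] dom.le_add_left[OF x(1)] by (simp add: cone_le_def)
      fix t assume "t \<in> s ` A"
      then obtain a where a: "a \<in> A" "t = s a" by blast
      have "cone_le C (x + z) (s a + z)" using lower[OF a(1)] by (simp add: cone_le_def)
      then have "cone_le K (f (x + z)) (f (s a + z))" using le_iff xz sC[OF a(1)] z dom.add_mem by simp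
      then show "cone_le K (f (x + z) - f z) (f t)"
        using s_add a by (simp add: cone_le_def algebra_simps)
    qed
    then show "cone_le K (f (x + z)) (f x + f z)" by (simp add: cone_le_def algebra_simps)
    \<comment> \<open>Here the infimum is the translated one, \<open>x + z\<close>, of the vectors
      \<open>s a + z\<close>.\<close>
    show "cone_le K (f x + f z) (f (x + z))"
    proof (rule image_inf_greatest[OF _ xz is_inf_translate[OF inf]])
      show "(\<lambda>x. x + z) ` s ` A \<subseteq> C" using sC z dom.add_mem by blast
      show "f x + f z \<in> K" using x(1) z image_mem cod.add_mem by blast
      fix t assume "t \<in> (\<lambda>x. x + z) ` s ` A"
      then obtain a where a: "a \<in> A" "t = s a + z" by blast
      have "cone_le K (f x) (f (s a))" using le_iff x(1) sC lower a(1) by simp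
      then show "cone_le K (f x + f z) (f t)" using s_add a by (simp add: cone_le_def)
    qed
  qed
qed

lemma additive_if_hull:
  assumes hull: "C = inf_sup_hull C (extreme_sums C)" and x: "x \<in> C" and y: "y \<in> C"
  shows "f (x + y) = f x + f y"
proof -
  have V: "extreme_sums C \<subseteq> C" using dom.extreme_sums_mem by blast
  \<comment> \<open>First pass: \<open>v\<close> is the fixed summand while \<open>y\<close> ranges
    over the hull. The second pass fixes \<open>y\<close> and extends the other argument.\<close>
  have "f (v + y) = f v + f y" if v: "v \<in> extreme_sums C" for v
    using additive_hull[OF V _ _ y, of v] additive_extreme_sums v V y hull
    by (auto simp: add.commute)
  then show ?thesis using additive_hull[OF V y _ x] hull x by blast
qed

section \<open>Linear extension to the whole space\<close>

lemma linear_extension: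
  assumes directed: "directed_cone C"
    and add: "\<And>x y. x \<in> C \<Longrightarrow> y \<in> C \<Longrightarrow> f (x + y) = f x + f y"
  shows "\<exists>T. linear T \<and> (\<forall>x\<in>C. f x = T x)"
proof -
  \<comment> \<open>A common upper bound of 0 and \<open>x\<close> writes \<open>x\<close> as a
    difference of two cone elements.\<close>
  have "\<exists>u\<in>C. u - x \<in> C" for x
    using directed unfolding directed_cone_def cone_le_def by (metis diff_zero)
  then obtain p where p: "\<And>x. p x \<in> C" "\<And>x. p x - x \<in> C" by metis
  define T where "T x = f (p x) - f (p x - x)" for x
  \<comment> \<open>The value does not depend on the chosen decomposition, so each law below can use
    whichever one suits it.\<close>
  have T: "T (u - w) = f u - f w" if "u \<in> C" "w \<in> C" for u w
  proof -
    let ?x = "u - w"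
    have "f (p ?x) + f w = f (p ?x + w)" using add p that by simp
    also have "p ?x + w = (p ?x - ?x) + u" by simp
    also have "f \<dots> = f (p ?x - ?x) + f u" using add p that by blast
    finally show ?thesis by (simp add: T_def algebra_simps)
  qed
  have T_add: "T (x + y) = T x + T y" for x y
  proof -
    have "x + y = (p x + p y) - ((p x - x) + (p y - y))" by simp
    also have "T \<dots> = f (p x + p y) - f ((p x - x) + (p y - y))"
      using p by (intro T dom.add_mem)
    also have "\<dots> = T x + T y" using add p by (simp add: T_def)
    finally show ?thesis .
  qed
  have T_scale_nonneg: "T (c *\<^sub>R x) = c *\<^sub>R T x" if "c \<ge> 0" for c x
  proof -
    have "c *\<^sub>R x = c *\<^sub>R p x - c *\<^sub>R (p x - x)" by (simp add: scaleR_diff_right)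
    also have "T \<dots> = f (c *\<^sub>R p x) - f (c *\<^sub>R (p x - x))"
      using p that by (intro T dom.scale_mem)
    also have "\<dots> = c *\<^sub>R T x"
      using p that by (simp only: T_def image_scale scaleR_diff_right[of c "f (p x)"])
    finally show ?thesis .
  qed
  have T_minus: "T (- x) = - T x" for x
    \<comment> \<open>Negation swaps the two cone elements of the decomposition.\<close>
    using T[OF p(2) p(1), of x x] by (simp add: T_def)
  have "T (c *\<^sub>R x) = c *\<^sub>R T x" for c x
    using T_scale_nonneg[of c x] T_scale_nonneg[of "- c" x] T_minus[of "c *\<^sub>R x"]
    by (cases "c \<ge> 0") auto
  then have "linear T" using T_add by (intro linearI) auto
  moreover have "f x = T x" if "x \<in> C" for x
    using T[OF that dom.zero_mem] by (simp add: image_zero)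
  ultimately show ?thesis by blast
qed

end

theorem theorem5p3:
  fixes C :: "'a::real_vector set" and K :: "'b::real_vector set" and f :: "'a \<Rightarrow> 'b"
  assumes "partially_ordered_vs C" and "archimedean_cone C"
    and "partially_ordered_vs K" and "archimedean_cone K"
    and "directed_cone C"
    and "C = inf_sup_hull C (extreme_sums C)"
    and "order_isomorphism_on C K f"
    and "positively_homogeneous_on C f"
  shows "\<exists>T. linear T \<and> (\<forall>x\<in>C. f x = T x)"
proof -
  interpret homogeneous_order_isomorphism C K f
    using assms by unfold_locales
  show ?thesis using linear_extension additive_if_hull assms by blast
qed

end
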